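(* Let $G$ be a connected simple graph that is 2-line existentially closed. Let $S$ be a set of new vertices, disjoint from $V(G)$, with $|S|\geq 2$. Let $G'$ be the graph with vertex set $V(G)\cup S$ whose edges are the edges of $G$ together with all pairs $\{x,v\}$ with $x\in S$ and $v\in V(G)$ (so that $S$ is an independent set in $G'$). Then $G'$ is 2-line existentially closed.
   Context: Two distinct edges of a graph are adjacent if they share at least one end vertex. A graph with at least two edges is 2-line existentially closed (2-line e.c.) if, for all disjoint sets of edges $A$ and $B$ with $|A\cup B|=2$ (either may be empty), there is an edge $e\notin A\cup B$ that is adjacent to each edge of $A$ and to no edge of $B$. *)

theory Defs
  imports Main
begin

record 'a graph =
  verts :: "'a set"
  edges :: "'a set set"

definition simple_graph :: "'a graph \<Rightarrow> bool" where
  "simple_graph G \<longleftrightarrow> (\<forall>e\<in>edges G. \<exists>u\<in>verts G. \<exists>v\<in>verts G. u \<noteq> v \<and> e = {u, v})"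

definition connected_graph :: "'a graph \<Rightarrow> bool" where
  "connected_graph G \<longleftrightarrow> verts G \<noteq> {} \<and>
     (\<forall>u\<in>verts G. \<forall>v\<in>verts G. (u, v) \<in> {(x, y). {x, y} \<in> edges G}\<^sup>*)"

text \<open>Graphs need not be finite, and \<^const>\<open>card\<close> is 0 on infinite sets.\<close>

definition at_least_two :: "'a set \<Rightarrow> bool" where
  "at_least_two X \<longleftrightarrow> infinite X \<or> 2 \<le> card X"

definition edge_adjacent :: "'a set \<Rightarrow> 'a set \<Rightarrow> bool" where
  "edge_adjacent e f \<longleftrightarrow> e \<noteq> f \<and> e \<inter> f \<noteq> {}"

definition two_line_ec :: "'a graph \<Rightarrow> bool" where
  "two_line_ec G \<longleftrightarrow> at_least_two (edges G) \<and>
     (\<forall>A B. A \<subseteq> edges G \<and> B \<subseteq> edges G \<and> A \<inter> B = {} \<and> card (A \<union> B) = 2 \<longrightarrow>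
        (\<exists>e\<in>edges G. e \<notin> A \<union> B \<and> (\<forall>f\<in>A. edge_adjacent e f) \<and> (\<forall>f\<in>B. \<not> edge_adjacent e f)))"

definition join_independent :: "'a graph \<Rightarrow> 'a set \<Rightarrow> 'a graph" where
  "join_independent G S =
     \<lparr>verts = verts G \<union> S, edges = edges G \<union> {{x, v} | x v. x \<in> S \<and> v \<in> verts G}\<rparr>"

lemma simple_graph_join_independent:
  assumes "simple_graph G" and "verts G \<inter> S = {}"
  shows "simple_graph (join_independent G S)"
  unfolding simple_graph_def
proof
  fix e assume "e \<in> edges (join_independent G S)"
  then consider "e \<in> edges G" | x v where "x \<in> S" "v \<in> verts G" "e = {x, v}"
    unfolding join_independent_def by auto
  then show "\<exists>u\<in>verts (join_independent G S). \<exists>v\<in>verts (join_independent G S). u \<noteq> v \<and> e = {u, v}"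
  proof cases
    case 1
    then obtain u v where "u \<in> verts G" "v \<in> verts G" "u \<noteq> v" "e = {u, v}"
      using assms(1) unfolding simple_graph_def by blast
    then show ?thesis
      unfolding join_independent_def by (intro bexI[of _ u] bexI[of _ v]) simp_all
  next
    case 2
    then have "x \<noteq> v" using assms(2) by blast
    with 2 show ?thesis
      unfolding join_independent_def by (intro bexI[of _ x] bexI[of _ v]) simp_all
  qed
qed

end

theory Submission
  imports Defs
begin

text \<open>Two edges of \<open>G\<close> are handled by \<open>G\<close> itself. In every other case a pair with one end
  in \<open>S\<close> works, with two exceptions: for two new edges with a common end \<open>v\<close> in \<open>G\<close>,
  connectedness provides an edge of \<open>G\<close> at \<open>v\<close>, which is adjacent to both; and for two new
  edges with ends \<open>u\<close>, \<open>v\<close> in \<open>G\<close>, an edge of \<open>G\<close> that avoids an edge at \<open>u\<close> and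
  an edge at \<open>v\<close> is adjacent to neither.\<close>

lemma at_least_two_ex_other:
  assumes "at_least_two X"
  shows "\<exists>y\<in>X. y \<noteq> x"
proof (rule ccontr)
  assume "\<not> ?thesis"
  then have "X \<subseteq> {x}" by blast
  then have "finite X" "card X \<le> 1"
    using finite_subset card_mono[of "{x}" X] by auto
  with assms show False by (simp add: at_least_two_def)
qed

lemma at_least_two_mono:
  assumes "at_least_two X" and "X \<subseteq> Y"
  shows "at_least_two Y"
proof (cases "finite Y")
  case True
  with assms show ?thesis
    using finite_subset[OF assms(2)] card_mono[OF True assms(2)] by (simp add: at_least_two_def)
qed (simp add: at_least_two_def)

text \<open>Trades the quantification over \<open>A\<close> and \<open>B\<close> for ordered pairs
  of edges: \<open>A = {f}\<close>, \<open>B = {e}\<close> is \<open>one\<close> with the roles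
  exchanged. Adjacency includes distinctness, so \<open>g\<close> has to be kept apart explicitly
  only from the edges that it is not adjacent to.\<close>

lemma two_line_ecI:
  assumes two: "at_least_two (edges G)"
    and both: "\<And>e f. e \<in> edges G \<Longrightarrow> f \<in> edges G \<Longrightarrow> e \<noteq> f \<Longrightarrow>
      \<exists>g\<in>edges G. edge_adjacent g e \<and> edge_adjacent g f"
    and one: "\<And>e f. e \<in> edges G \<Longrightarrow> f \<in> edges G \<Longrightarrow> e \<noteq> f \<Longrightarrow>
      \<exists>g\<in>edges G. edge_adjacent g e \<and> g \<noteq> f \<and> \<not> edge_adjacent g f"
    and none: "\<And>e f. e \<in> edges G \<Longrightarrow> f \<in> edges G \<Longrightarrow> e \<noteq> f \<Longrightarrow>
      \<exists>g\<in>edges G. g \<noteq> e \<and> \<not> edge_adjacent g e \<and> g \<noteq> f \<and> \<not> edge_adjacent g f"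
  shows "two_line_ec G"
  unfolding two_line_ec_def
proof (intro conjI allI impI two)
  fix A B
  assume *: "A \<subseteq> edges G \<and> B \<subseteq> edges G \<and> A \<inter> B = {} \<and> card (A \<union> B) = 2"
  then obtain e f where ef: "A \<union> B = {e, f}" "e \<noteq> f" by (auto simp: card_2_iff)
  with * have E: "e \<in> edges G" "f \<in> edges G" by auto
  have adj_ne: "g \<noteq> h" if "edge_adjacent g h" for g h :: "'a set" using that by (simp add: edge_adjacent_def)
  have "A \<subseteq> {e, f}" and B: "B = {e, f} - A" using * ef(1) by auto
  then consider "A = {e, f}" "B = {}" | "A = {e}" "B = {f}" | "A = {f}" "B = {e}"
    | "A = {}" "B = {e, f}"
    using ef(2) unfolding subset_insert_iff by (cases "e \<in> A"; cases "f \<in> A") auto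
  then show "\<exists>g\<in>edges G. g \<notin> A \<union> B \<and> (\<forall>h\<in>A. edge_adjacent g h) \<and> (\<forall>h\<in>B. \<not> edge_adjacent g h)"
  proof cases
    case 1
    obtain g where g: "g \<in> edges G" "edge_adjacent g e" "edge_adjacent g f"
      using both[OF E ef(2)] by blast
    with adj_ne[OF g(2)] adj_ne[OF g(3)] 1 show ?thesis by (intro bexI[of _ g]) auto
  next
    case 2
    obtain g where g: "g \<in> edges G" "edge_adjacent g e" "g \<noteq> f" "\<not> edge_adjacent g f"
      using one[OF E ef(2)] by blast
    with adj_ne[OF g(2)] 2 show ?thesis by (intro bexI[of _ g]) auto
  next
    case 3
    obtain g where g: "g \<in> edges G" "edge_adjacent g f" "g \<noteq> e" "\<not> edge_adjacent g e"
      using one[OF E(2,1)] ef(2) by blast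
    with adj_ne[OF g(2)] 3 show ?thesis by (intro bexI[of _ g]) auto
  next
    case 4
    with none[OF E ef(2)] show ?thesis by auto
  qed
qed

lemma two_line_ecD:
  assumes "two_line_ec G" and "e \<in> edges G" and "f \<in> edges G" and "e \<noteq> f"
  shows "\<exists>g\<in>edges G. edge_adjacent g e \<and> edge_adjacent g f"
    and "\<exists>g\<in>edges G. edge_adjacent g e \<and> g \<noteq> f \<and> \<not> edge_adjacent g f"
    and "\<exists>g\<in>edges G. g \<noteq> e \<and> \<not> edge_adjacent g e \<and> g \<noteq> f \<and> \<not> edge_adjacent g f"
proof -
  have ec: "\<exists>g\<in>edges G. g \<notin> A \<union> B \<and> (\<forall>h\<in>A. edge_adjacent g h) \<and> (\<forall>h\<in>B. \<not> edge_adjacent g h)"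
    if "A \<subseteq> edges G" "B \<subseteq> edges G" "A \<inter> B = {}" "card (A \<union> B) = 2" for A B
    using assms(1) that unfolding two_line_ec_def by blast
  show "\<exists>g\<in>edges G. edge_adjacent g e \<and> edge_adjacent g f"
    using ec[of "{e, f}" "{}"] assms(2-4) by auto
  show "\<exists>g\<in>edges G. edge_adjacent g e \<and> g \<noteq> f \<and> \<not> edge_adjacent g f"
    using ec[of "{e}" "{f}"] assms(2-4) by auto
  show "\<exists>g\<in>edges G. g \<noteq> e \<and> \<not> edge_adjacent g e \<and> g \<noteq> f \<and> \<not> edge_adjacent g f"
    using ec[of "{}" "{e, f}"] assms(2-4) by auto
qed

text \<open>For distinct edges, non-adjacency means disjointness. The case \<open>e = f\<close> is
  included, since the lemma is later applied to edges that may coincide; a second edge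
  \<open>f'\<close> then completes the pair.\<close>

lemma two_line_ec_disjoint_edge:
  assumes ec: "two_line_ec G" and e: "e \<in> edges G" and f: "f \<in> edges G"
  shows "\<exists>g\<in>edges G. g \<inter> e = {} \<and> g \<inter> f = {}"
proof -
  obtain f' where f': "f' \<in> edges G" "f' \<noteq> e" "e \<noteq> f \<Longrightarrow> f' = f"
    using at_least_two_ex_other[of "edges G" e] ec f unfolding two_line_ec_def by metis
  obtain g where "g \<in> edges G" "g \<noteq> e" "\<not> edge_adjacent g e" "g \<noteq> f'" "\<not> edge_adjacent g f'"
    using two_line_ecD(3)[OF ec e f'(1)] f'(2) by blast
  then show ?thesis using f'(3) unfolding edge_adjacent_def by blast
qed

text \<open>The first step of a walk from \<open>v\<close> to another vertex is an edge at
  \<open>v\<close>.\<close>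

lemma connected_graph_incident_edge:
  assumes "connected_graph G" and "u \<in> verts G" and "v \<in> verts G" and "v \<noteq> u"
  shows "\<exists>w. {v, w} \<in> edges G"
proof -
  have "(v, u) \<in> {(x, y). {x, y} \<in> edges G}\<^sup>*"
    using assms(1-3) unfolding connected_graph_def by blast
  then show ?thesis using assms(4) by (auto elim: converse_rtranclE)
qed

theorem theorem6:
  fixes G :: "'a graph" and S :: "'a set"
  assumes "simple_graph G"
    and "connected_graph G"
    and "two_line_ec G"
    and "S \<inter> verts G = {}"
    and "at_least_two S"
  shows "two_line_ec (join_independent G S)"
proof -
  let ?H = "join_independent G S"
  note ec = assms(3)
  have two: "at_least_two (edges G)" using ec unfolding two_line_ec_def by blast
  have old: "h \<in> edges ?H" if "h \<in> edges G" for h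
    using that by (simp add: join_independent_def)
  have new: "{x, v} \<in> edges ?H" if "x \<in> S" "v \<in> verts G" for x v
    using that by (auto simp: join_independent_def)
  have split: "e \<in> edges G \<or> (\<exists>x v. x \<in> S \<and> v \<in> verts G \<and> e = {x, v})"
    if "e \<in> edges ?H" for e
    using that by (auto simp: join_independent_def)
  have ends: "\<exists>a b. a \<in> verts G \<and> b \<in> verts G \<and> a \<noteq> b \<and> e = {a, b}" if "e \<in> edges G" for e
    using assms(1) that unfolding simple_graph_def by blast
  have notS: "x \<noteq> v" "v \<noteq> x" if "x \<in> S" "v \<in> verts G" for x v
    using assms(4) that by auto
  have otherS: "\<exists>y\<in>S. y \<noteq> x" for x
    using at_least_two_ex_other[OF assms(5)] by blast
  \<comment> \<open>An edge disjoint from \<open>e\<close> has two ends, and at most one of them is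
    \<open>v\<close>.\<close>
  have fresh_edge: "\<exists>w\<in>verts G. w \<notin> e \<and> w \<noteq> v" if e: "e \<in> edges G" for e v
  proof -
    obtain g where g: "g \<in> edges G" "g \<inter> e = {}"
      using two_line_ec_disjoint_edge[OF ec e e] by blast
    with ends[OF g(1)] show ?thesis by blast
  qed
  obtain e0 where e0: "e0 \<in> edges G" using at_least_two_ex_other[OF two] by blast
  have fresh: "\<exists>w\<in>verts G. w \<noteq> u \<and> w \<noteq> v" for u v
  proof -
    obtain a b where ab: "a \<in> verts G" "b \<in> verts G" "a \<noteq> b" "e0 = {a, b}"
      using ends[OF e0] by blast
    obtain w where "w \<in> verts G" "w \<notin> e0" "w \<noteq> u" using fresh_edge[OF e0] by blast
    \<comment> \<open>If \<open>w = v\<close>, both ends of \<open>e0\<close> differ from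
      \<open>v\<close>, and one of them also differs from \<open>u\<close>.\<close>
    with ab show ?thesis by (cases "w = v"; cases "a = u") auto
  qed
  have at_vertex: "\<exists>w\<in>verts G. {v, w} \<in> edges G" if v: "v \<in> verts G" for v
  proof -
    obtain u where "u \<in> verts G" "u \<noteq> v" using fresh by blast
    then obtain w where "{v, w} \<in> edges G"
      using connected_graph_incident_edge[OF assms(2) _ v] by blast
    with ends[OF this] show ?thesis by (auto simp: doubleton_eq_iff)
  qed
  have avoid: "\<exists>g\<in>edges G. u \<notin> g \<and> v \<notin> g" if uv: "u \<in> verts G" "v \<in> verts G" for u v
  proof -
    \<comment> \<open>These two edges are the same when, for instance, \<open>u'\<close> is
      \<open>v\<close> and \<open>v'\<close> is \<open>u\<close>.\<close>
    obtain u' v' where "{u, u'} \<in> edges G" "{v, v'} \<in> edges G" using at_vertex uv by blast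
    from two_line_ec_disjoint_edge[OF ec this] show ?thesis by blast
  qed
  \<comment> \<open>An old edge \<open>e\<close> and a new edge \<open>f\<close> play different
    roles, so the one-sided property is stated in both directions.\<close>
  have mixed:
    "\<exists>g\<in>edges ?H. edge_adjacent g e \<and> edge_adjacent g f"
    "\<exists>g\<in>edges ?H. edge_adjacent g e \<and> g \<noteq> f \<and> \<not> edge_adjacent g f"
    "\<exists>g\<in>edges ?H. edge_adjacent g f \<and> g \<noteq> e \<and> \<not> edge_adjacent g e"
    "\<exists>g\<in>edges ?H. g \<noteq> e \<and> \<not> edge_adjacent g e \<and> g \<noteq> f \<and> \<not> edge_adjacent g f"
    if e: "e \<in> edges G" and xv: "x \<in> S" "v \<in> verts G" and f: "f = {x, v}" for e f x v
  proof -
    \<comment> \<open>Naming the ends so that \<open>a\<close> is not \<open>v\<close> makes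
      \<open>{x, a}\<close> differ from \<open>f\<close> and \<open>{y, a}\<close> disjoint from
      \<open>f\<close>.\<close>
    obtain a b where ab: "a \<in> verts G" "b \<in> verts G" "a \<noteq> v" "e = {a, b}"
    proof -
      obtain a b where "a \<in> verts G" "b \<in> verts G" "a \<noteq> b" "e = {a, b}"
        using ends[OF e] by blast
      then show thesis using that[of a b] that[of b a] by (cases "a = v") auto
    qed
    obtain y where y: "y \<in> S" "y \<noteq> x" using otherS by blast
    \<comment> \<open>A new edge ending at \<open>w\<close> misses \<open>e\<close>; whether it
      meets \<open>f\<close> is then decided by its end in \<open>S\<close>: \<open>x\<close> for
      yes, \<open>y\<close> for no.\<close>
    obtain w where w: "w \<in> verts G" "w \<notin> e" "w \<noteq> v" using fresh_edge[OF e] by blast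
    note ne = notS[OF xv(1) xv(2)] notS[OF xv(1) ab(1)] notS[OF xv(1) ab(2)] notS[OF xv(1) w(1)]
      notS[OF y(1) xv(2)] notS[OF y(1) ab(1)] notS[OF y(1) ab(2)] notS[OF y(1) w(1)]
    show "\<exists>g\<in>edges ?H. edge_adjacent g e \<and> edge_adjacent g f"
      using new[OF xv(1) ab(1)] ab f ne
      by (intro bexI[of _ "{x, a}"]) (auto simp: edge_adjacent_def doubleton_eq_iff)
    show "\<exists>g\<in>edges ?H. edge_adjacent g e \<and> g \<noteq> f \<and> \<not> edge_adjacent g f"
      using new[OF y(1) ab(1)] ab f y ne
      by (intro bexI[of _ "{y, a}"]) (auto simp: edge_adjacent_def doubleton_eq_iff)
    show "\<exists>g\<in>edges ?H. edge_adjacent g f \<and> g \<noteq> e \<and> \<not> edge_adjacent g e"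
      using new[OF xv(1) w(1)] ab f w ne
      by (intro bexI[of _ "{x, w}"]) (auto simp: edge_adjacent_def doubleton_eq_iff)
    show "\<exists>g\<in>edges ?H. g \<noteq> e \<and> \<not> edge_adjacent g e \<and> g \<noteq> f \<and> \<not> edge_adjacent g f"
      using new[OF y(1) w(1)] ab f w y ne
      by (intro bexI[of _ "{y, w}"]) (auto simp: edge_adjacent_def doubleton_eq_iff)
  qed
  have both_new:
    "\<exists>g\<in>edges ?H. edge_adjacent g e \<and> edge_adjacent g f" (is ?both)
    "\<exists>g\<in>edges ?H. edge_adjacent g e \<and> g \<noteq> f \<and> \<not> edge_adjacent g f" (is ?one)
    "\<exists>g\<in>edges ?H. g \<noteq> e \<and> \<not> edge_adjacent g e \<and> g \<noteq> f \<and> \<not> edge_adjacent g f" (is ?none)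
    if xu: "x \<in> S" "u \<in> verts G" "e = {x, u}" and yv: "y \<in> S" "v \<in> verts G" "f = {y, v}"
      and ne: "e \<noteq> f" for e f x y u v
  proof -
    obtain w where w: "w \<in> verts G" "w \<noteq> u" "w \<noteq> v" using fresh by blast
    note neq = notS[OF xu(1,2)] notS[OF xu(1) yv(2)] notS[OF yv(1) xu(2)] notS[OF yv(1,2)]
      notS[OF xu(1) w(1)] notS[OF yv(1) w(1)]
    show ?both
    proof (cases "u = v")
      case True
      obtain t where t: "t \<in> verts G" "{v, t} \<in> edges G" using at_vertex[OF yv(2)] by blast
      show ?thesis
        using old[OF t(2)] True xu yv notS[OF xu(1) t(1)] notS[OF yv(1) t(1)] neq
        by (intro bexI[of _ "{v, t}"]) (auto simp: edge_adjacent_def doubleton_eq_iff)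
    next
      case False
      show ?thesis
      proof (cases "x = y")
        case True
        \<comment> \<open>Both edges contain \<open>x\<close>, and a third end \<open>w\<close>
          gives another edge at \<open>x\<close>.\<close>
        then show ?thesis using new[OF xu(1) w(1)] xu yv w neq
          by (intro bexI[of _ "{x, w}"]) (auto simp: edge_adjacent_def doubleton_eq_iff)
      next
        case xy: False
        \<comment> \<open>Now \<open>e\<close> and \<open>f\<close> are disjoint, and the crossing
          edge \<open>{x, v}\<close> takes one end from each.\<close>
        then show ?thesis using new[OF xu(1) yv(2)] False xu yv neq
          by (intro bexI[of _ "{x, v}"]) (auto simp: edge_adjacent_def doubleton_eq_iff)
      qed
    qed
    show ?one
    proof (cases "x = y")
      case True
      \<comment> \<open>Here \<open>u\<close> and \<open>v\<close> differ because \<open>e\<close>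
        and \<open>f\<close> do, so \<open>{z, u}\<close> meets \<open>e\<close> in \<open>u\<close>
        and misses \<open>f\<close>.\<close>
      obtain z where z: "z \<in> S" "z \<noteq> x" using otherS by blast
      show ?thesis
        using True new[OF z(1) xu(2)] ne xu yv z notS[OF z(1) xu(2)] notS[OF z(1) yv(2)] neq
        by (intro bexI[of _ "{z, u}"]) (auto simp: edge_adjacent_def doubleton_eq_iff)
    next
      case False
      \<comment> \<open>The edge \<open>{x, w}\<close> meets \<open>e\<close> in \<open>x\<close>;
        it misses \<open>f\<close> since \<open>x\<close> is not \<open>y\<close> and
        \<open>w\<close> is not \<open>v\<close>.\<close>
      then show ?thesis using new[OF xu(1) w(1)] xu yv w neq
        by (intro bexI[of _ "{x, w}"]) (auto simp: edge_adjacent_def doubleton_eq_iff)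
    qed
    obtain g where g: "g \<in> edges G" "u \<notin> g" "v \<notin> g" using avoid[OF xu(2) yv(2)] by blast
    have "g \<inter> S = {}" using ends[OF g(1)] assms(4) by auto
    then show ?none
      using old[OF g(1)] g xu yv by (intro bexI[of _ g]) (auto simp: edge_adjacent_def)
  qed
  show ?thesis
  proof (rule two_line_ecI)
    show "at_least_two (edges ?H)" using at_least_two_mono[OF two] old by blast
  next
    fix e f assume e: "e \<in> edges ?H" and f: "f \<in> edges ?H" and ne: "e \<noteq> f"
    then consider "e \<in> edges G" "f \<in> edges G"
      | x v where "e \<in> edges G" "x \<in> S" "v \<in> verts G" "f = {x, v}"
      | x v where "f \<in> edges G" "x \<in> S" "v \<in> verts G" "e = {x, v}"
      | x u y v where "x \<in> S" "u \<in> verts G" "e = {x, u}" "y \<in> S" "v \<in> verts G" "f = {y, v}"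
      using split[OF e] split[OF f] by blast
    then have "(\<exists>g\<in>edges ?H. edge_adjacent g e \<and> edge_adjacent g f) \<and>
      (\<exists>g\<in>edges ?H. edge_adjacent g e \<and> g \<noteq> f \<and> \<not> edge_adjacent g f) \<and>
      (\<exists>g\<in>edges ?H. g \<noteq> e \<and> \<not> edge_adjacent g e \<and> g \<noteq> f \<and> \<not> edge_adjacent g f)"
    proof cases
      case 1
      \<comment> \<open>Adjacency depends only on the two edges, so witnesses in \<open>G\<close>
        remain valid in \<open>?H\<close>.\<close>
      from two_line_ecD[OF ec this ne] show ?thesis using old by meson
    next
      case 2
      from mixed[OF this] show ?thesis by blast
    next
      case 3
      from mixed[OF this] show ?thesis by blast
    next
      case 4
      from both_new[OF this ne] show ?thesis by blast
    qed
    then show "\<exists>g\<in>edges ?H. edge_adjacent g e \<and> edge_adjacent g f"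
      and "\<exists>g\<in>edges ?H. edge_adjacent g e \<and> g \<noteq> f \<and> \<not> edge_adjacent g f"
      and "\<exists>g\<in>edges ?H. g \<noteq> e \<and> \<not> edge_adjacent g e \<and> g \<noteq> f \<and> \<not> edge_adjacent g f"
      by blast+
  qed
qed

end
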